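(* For every integer $r \geq 10$, $p_1 p_2 \cdots p_r > 2^{p_{r+1}}$. For every integer $r$ with $0 < r < 10$ and $r \neq 8$, $p_1 p_2 \cdots p_r < 2^{p_{r+1}}$.
   Context: $p_n$ denotes the $n$th prime (so $p_1 = 2$, $p_2 = 3$, $p_3 = 5$, ...). *)

theory Defs
  imports "HOL-Computational_Algebra.Primes" "HOL-Library.Infinite_Set"
begin

(* Indexing starts at 1, whereas enumerate counts from 0; the value at 0 is junk
   (it coincides with the value at 1). *)
definition nth_prime :: "nat \<Rightarrow> nat" where
  "nth_prime n = enumerate {p. prime p} (n - 1)"

end

theory Submission
  imports Defs "HOL-Analysis.Harmonic_Numbers" "HOL-Library.Discrete_Functions"
begin

text \<open>
  The product of the first \<open>r\<close> primes is the primorial of \<open>x = nth_prime (r + 1) - 1\<close>, so the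
  first claim says that the primorial of \<open>x\<close> exceeds \<open>2 ^ (x + 1)\<close>; this holds for all \<open>x \<ge> 31\<close>.
  For large \<open>x\<close> we use a Chebyshev quotient: \<open>(6n)! n! / ((3n)! (2n)!\<^sup>2)\<close> is at least
  \<open>108 ^ n / (4n)\<close>, whereas by Legendre's formula it divides the product of the largest prime
  powers up to \<open>6n\<close>. The latter exceeds the primorial of \<open>6n\<close> only by a factor
  \<open>(6n) ^ \<pi>(sqrt (6n))\<close>, which is negligible against \<open>(108 / 64) ^ n\<close>. The central binomial
  coefficient would not do, as its growth rate is just \<open>2 ^ x\<close>. Below 1380 a list of primes
  is multiplied up.
\<close>

section \<open>Elementary properties of the primorial\<close>

definition primorial :: "nat \<Rightarrow> nat" where
  "primorial x = \<Prod>{p. prime p \<and> p \<le> x}"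

lemma finite_primes_le: "finite {p::nat. prime p \<and> p \<le> x}"
  by (rule finite_subset[of _ "{..x}"]) auto

lemma primorial_pos: "primorial x > 0"
  unfolding primorial_def by (intro prod_pos) (auto simp: prime_gt_0_nat)

lemma prod_primes_le_primorial:
  assumes "A \<subseteq> {p. prime p \<and> p \<le> x}"
  shows "\<Prod>A \<le> primorial x"
  using prod_dvd_prod_subset[OF finite_primes_le assms, of "\<lambda>p. p"] primorial_pos
  unfolding primorial_def by (intro dvd_imp_le) auto

lemma primorial_mono: "x \<le> y \<Longrightarrow> primorial x \<le> primorial y"
  by (subst primorial_def, rule prod_primes_le_primorial) auto

lemma primorial_prime_ge:
  assumes "prime p" "m < p"
  shows "primorial m * p \<le> primorial p"
proof -
  have "\<Prod>(insert p {q. prime q \<and> q \<le> m}) \<le> primorial p"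
    using assms by (intro prod_primes_le_primorial) auto
  then show ?thesis
    using assms by (subst (asm) prod.insert) (auto simp: finite_primes_le primorial_def mult.commute)
qed

section \<open>The range below 1380\<close>

text \<open>Trial division: a composite number below 1369 = 37^2 has a prime factor below 37, and
  the list consists of all primes below 37.\<close>

lemma prime_if_no_small_prime_dvd:
  fixes p :: nat
  assumes "1 < p" "p < 1369"
    and nd: "\<forall>d\<in>set [2, 3, 5, 7, 11, 13, 17, 19, 23, 29, 31]. \<not> d dvd p"
  shows "prime p"
proof (rule ccontr)
  assume "\<not> prime p"
  then obtain a b where ab: "p = a * b" "1 < a" "a \<le> b"
    using assms(1) unfolding prime_nat_iff
    by (metis dvd_def linorder_le_cases mult.commute nat_mult_1_right
      One_nat_def gr0I less_one linorder_neqE_nat mult_is_0)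
  obtain q where q: "prime q" "q dvd a"
    using ab prime_factor_nat[of a] by auto
  have "q \<le> a" using q ab by (intro dvd_imp_le) auto
  then have "q\<^sup>2 \<le> p" unfolding ab(1) power2_eq_square using ab by (intro mult_le_mono) auto
  then have "q\<^sup>2 < 37\<^sup>2" using assms(2) by simp
  then have "q < 37" by (rule power_less_imp_less_base) simp
  have "q dvd p" using q ab by simp
  then have nd': "\<not> d dvd q" if "d \<in> set [2, 3, 5, 7, 11, 13, 17, 19, 23, 29, 31]" for d
    using nd that dvd_trans by blast
  have "q \<in> set [1..<37]" using \<open>q < 37\<close> q(1) by (auto simp: Suc_le_eq prime_gt_0_nat)
  \<comment> \<open>A finite check covers all candidates for \<open>q\<close>: by \<open>nd'\<close>
    no listed number divides \<open>q\<close>, which leaves only 1.\<close>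
  moreover have "\<forall>r\<in>set [1..<37]. r = 1 \<or> (\<exists>d\<in>set [2::nat, 3, 5, 7, 11, 13, 17, 19, 23, 29, 31]. d dvd r)"
    by code_simp
  ultimately have "q = 1" using nd' by blast
  then show False using q(1) by simp
qed

text \<open>
  Here \<open>k\<close> and \<open>e\<close> are lower bounds for the binary logarithms of \<open>m\<close> and of its
  primorial. Keeping only these rounded logarithms avoids rewriting with large numerals.
\<close>

fun prime_chain :: "nat \<Rightarrow> nat \<Rightarrow> nat \<Rightarrow> nat \<Rightarrow> nat list \<Rightarrow> bool" where
  "prime_chain N k m e [] \<longleftrightarrow> N \<le> e"
| "prime_chain N k m e (p # ps) \<longleftrightarrow>
     m < p \<and> p \<le> e \<and> p < 1369 \<and>
     (\<forall>d\<in>set [2, 3, 5, 7, 11, 13, 17, 19, 23, 29, 31]. \<not> d dvd p) \<and>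
     (if 2 ^ (k + 1) \<le> p then prime_chain N (k + 1) p (e + (k + 1)) ps
      else prime_chain N k p (e + k) ps)"

text \<open>In the gap \<open>m \<le> x < p\<close> the condition \<open>p \<le> e\<close> yields
  2^(x+1) \<le> 2^e, which is below the primorial of \<open>m\<close>. For \<open>x \<ge> p\<close>
  the factor \<open>p\<close> adds its rounded logarithm to \<open>e\<close> and the induction
  continues. After the last prime, \<open>N \<le> e\<close> covers the rest.\<close>

lemma prime_chain_imp_primorial:
  assumes "prime_chain N k m e ps" "2 ^ k \<le> m" "2 ^ e < primorial m" "m \<le> x" "x < N"
  shows "2 ^ (x + 1) < primorial x"
  using assms
proof (induction N k m e ps rule: prime_chain.induct)
  case (1 N k m e)
  then have "(2::nat) ^ (x + 1) \<le> 2 ^ e" by (intro power_increasing) auto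
  with 1 primorial_mono[of m x] show ?case by simp
next
  case (2 N k m e p ps)
  show ?case
  proof (cases "x < p")
    case True
    then have "(2::nat) ^ (x + 1) \<le> 2 ^ e" using 2 by (intro power_increasing) auto
    with 2 primorial_mono[of m x] show ?thesis by simp
  next
    case False
    \<comment> \<open>Only \<open>1 < p\<close> is missing for the trial division.\<close>
    have "(1::nat) \<le> 2 ^ k" by simp
    also have "2 ^ k \<le> m" using 2 by simp
    also have "m < p" using 2 by simp
    finally have p: "prime p" "m < p"
      using 2 by (auto intro!: prime_if_no_small_prime_dvd)
    have step: "2 ^ (e + j) < primorial p" if "2 ^ j \<le> p" for j
    proof -
      have "(2::nat) ^ (e + j) \<le> 2 ^ e * p" using that by (simp add: power_add)
      also have "\<dots> < primorial m * p" using 2 p by simp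
      also have "\<dots> \<le> primorial p" using p by (intro primorial_prime_ge) auto
      finally show ?thesis .
    qed
    show ?thesis
    proof (cases "2 ^ (k + 1) \<le> p")
      case True
      then show ?thesis using 2 False step[of "k + 1"] by simp
    next
      case not_le: False
      then show ?thesis using 2 False step[of k] by simp
    qed
  qed
qed

text \<open>The exponent 37 is the largest possible, and just enough to reach the next prime 37 in
  the chain.\<close>

lemma primorial_31_ge: "2 ^ 37 < primorial 31"
  using prod_primes_le_primorial[of "{2,3,5,7,11,13,17,19,23,29,31}" 31] by simp

lemma primorial_gt_small:
  assumes "31 \<le> x" "x < 1380"
  shows "2 ^ (x + 1) < primorial x"
proof -
  \<comment> \<open>The chain can stop at 1051 because the accumulated exponent has then reached
    1380.\<close>
  have "prime_chain 1380 4 31 37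
     [37, 41, 43, 47, 53, 59, 61, 67, 71, 73, 79, 83, 89, 97, 101, 103, 107, 109, 113,
      127, 131, 137, 139, 149, 151, 157, 163, 167, 173, 179, 181, 191, 193, 197, 199,
      211, 223, 227, 229, 233, 239, 241, 251, 257, 263, 269, 271, 277, 281, 283, 293,
      307, 311, 313, 317, 331, 337, 347, 349, 353, 359, 367, 373, 379, 383, 389, 397,
      401, 409, 419, 421, 431, 433, 439, 443, 449, 457, 461, 463, 467, 479, 487, 491,
      499, 503, 509, 521, 523, 541, 547, 557, 563, 569, 571, 577, 587, 593, 599, 601,
      607, 613, 617, 619, 631, 641, 643, 647, 653, 659, 661, 673, 677, 683, 691, 701,
      709, 719, 727, 733, 739, 743, 751, 757, 761, 769, 773, 787, 797, 809, 811, 821,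
      823, 827, 829, 839, 853, 857, 859, 863, 877, 881, 883, 887, 907, 911, 919, 929,
      937, 941, 947, 953, 967, 971, 977, 983, 991, 997, 1009, 1013, 1019, 1021, 1031,
      1033, 1039, 1049, 1051]"
    by simp
  from prime_chain_imp_primorial[OF this _ primorial_31_ge] assms show ?thesis by simp
qed

section \<open>Legendre's formula and the Chebyshev quotient\<close>

lemma Suc_div_dvd: "Suc n div d = n div d + (if d dvd Suc n then 1 else 0)"
  by (simp add: div_Suc dvd_eq_mod_eq_0)

lemma multiplicity_eq_card:
  fixes p n :: nat
  assumes "prime p" "0 < n" "n < p ^ Suc K"
  shows "multiplicity p n = card {k \<in> {1..K}. p ^ k dvd n}"
proof -
  have iff: "p ^ k dvd n \<longleftrightarrow> k \<le> multiplicity p n" for k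
    using assms by (intro power_dvd_iff_le_multiplicity) (auto simp: prime_gt_1_nat not_is_unit_0)
  have "p ^ multiplicity p n \<le> n"
    using assms by (intro dvd_imp_le multiplicity_dvd)
  then have "p ^ multiplicity p n < p ^ Suc K" using assms by linarith
  then have "multiplicity p n < Suc K"
    using assms prime_gt_1_nat power_less_imp_less_exp by blast
  then have "{k \<in> {1..K}. p ^ k dvd n} = {1..multiplicity p n}"
    unfolding iff by auto
  then show ?thesis by simp
qed

text \<open>Legendre's formula, cut off at any \<open>K\<close> beyond which the powers of
  \<open>p\<close> exceed \<open>n\<close>. Passing to \<open>Suc n\<close> raises the
  \<open>k\<close>-th quotient by one exactly when \<open>p ^ k\<close> divides
  \<open>Suc n\<close>.\<close>

lemma multiplicity_fact:
  fixes p n :: nat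
  assumes "prime p" "n < p ^ Suc K"
  shows "multiplicity p (fact n) = (\<Sum>k=1..K. n div p ^ k)"
  using assms(2)
proof (induction n)
  case 0
  then show ?case by simp
next
  case (Suc n)
  have "multiplicity p (fact (Suc n)) = multiplicity p (Suc n) + multiplicity p (fact n)"
    using assms(1) by (simp only: fact_Suc of_nat_id)
      (subst prime_elem_multiplicity_mult_distrib, auto)
  also have "multiplicity p (Suc n) = (\<Sum>k=1..K. if p ^ k dvd Suc n then 1 else 0)"
    using multiplicity_eq_card[OF assms(1) _ Suc.prems] by (simp add: sum.If_cases Int_def)
  also have "multiplicity p (fact n) = (\<Sum>k=1..K. n div p ^ k)"
    using Suc by simp
  finally show ?case
    by (simp add: sum.distrib[symmetric] Suc_div_dvd add.commute)
qed

text \<open>Compare multiplicities prime by prime: in Legendre's sums each power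
  \<open>p ^ k\<close> contributes an excess of at most 1 on the left, and there are at most
  \<open>e p\<close> such powers.\<close>

lemma fact_mult_fact_dvd:
  fixes e :: "nat \<Rightarrow> nat"
  assumes e: "\<And>p. prime p \<Longrightarrow> p \<le> x \<Longrightarrow> x < p ^ Suc (e p)"
  shows "fact x * fact (x div 6) dvd
    fact (x div 2) * fact (x div 3) ^ 2 * (\<Prod>p | prime p \<and> p \<le> x. p ^ e p)"
proof (rule multiplicity_le_imp_dvd)
  fix p :: nat assume p: "prime p"
  let ?S = "{p. prime p \<and> p \<le> x}"
  let ?D = "\<Prod>p\<in>?S. p ^ e p"
  \<comment> \<open>For \<open>p > x\<close> the cut-off 0 works, since then already
    \<open>x < p ^ 1\<close>.\<close>
  let ?K = "if p \<le> x then e p else 0"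
  have x: "x < p ^ Suc ?K" using e p by auto
  have mult: "multiplicity p (fact (x div c)) = (\<Sum>k=1..?K. x div c div p ^ k)" for c
    using div_le_dividend[of x c] x by (intro multiplicity_fact[OF p]) linarith
  have D: "?D \<noteq> 0" using finite_primes_le by (auto simp: prime_gt_0_nat)
  have K: "?K \<le> multiplicity p ?D"
  proof (cases "p \<le> x")
    case True
    then have "p ^ e p dvd ?D" using p finite_primes_le by (intro dvd_prodI) auto
    then show ?thesis using True D p by (simp only: if_True) (intro multiplicity_geI, auto)
  qed simp
  \<comment> \<open>Iterated divisions commute, so everything depends on \<open>t = x div d\<close>
    alone, and the inequality has period 6 in \<open>t\<close>.\<close>
  have digit: "x div d + x div 6 div d \<le> x div 2 div d + 2 * (x div 3 div d) + 1" for d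
  proof -
    have "t + t div 6 \<le> t div 2 + 2 * (t div 3) + 1" for t :: nat by presburger
    from this[of "x div d"] show ?thesis
      by (simp add: div_mult2_eq[symmetric] mult.commute)
  qed
  have "multiplicity p (fact x * fact (x div 6)) =
      (\<Sum>k=1..?K. x div p ^ k + x div 6 div p ^ k)"
    using p mult[of 1] mult[of 6] by (simp add: prime_elem_multiplicity_mult_distrib sum.distrib)
  also have "\<dots> \<le> (\<Sum>k=1..?K. x div 2 div p ^ k + 2 * (x div 3 div p ^ k) + 1)"
    by (intro sum_mono digit)
  also have "\<dots> = multiplicity p (fact (x div 2)) + 2 * multiplicity p (fact (x div 3)) + ?K"
    unfolding mult by (simp add: sum.distrib sum_Suc sum_distrib_left)
  also have "\<dots> \<le> multiplicity p (fact (x div 2) * fact (x div 3) ^ 2 * ?D)"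
    using p D K
    by (simp add: prime_elem_multiplicity_mult_distrib prime_elem_multiplicity_power_distrib)
  finally show "multiplicity p (fact x * fact (x div 6)) \<le> \<dots>" .
qed simp

section \<open>Prime powers against the primorial\<close>

text \<open>Among 3t, 3t+1, 3t+2 at most one is a prime above 3: the first is a multiple of 3, and
  one of the other two is even. The summand 2 accounts for the primes 2 and 3.\<close>

lemma card_primes_le: "card {p. prime p \<and> p \<le> k} \<le> k div 3 + 2"
proof -
  let ?A = "{p. prime p \<and> p \<le> k \<and> 3 < p}"
  have fin: "finite ?A" by (rule finite_subset[OF _ finite_primes_le[of k]]) auto
  have nd: "\<not> q dvd p" if "p \<in> ?A" "q = 2 \<or> q = 3" for p q
    using that by (auto simp: primes_dvd_imp_eq dest: primes_dvd_imp_eq[rotated 2])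
  have "inj_on (\<lambda>p. p div 3) ?A"
  proof (rule inj_onI)
    fix p q assume "p \<in> ?A" "q \<in> ?A" "p div 3 = q div 3"
    moreover from this have "\<not> 2 dvd p" "\<not> 3 dvd p" "\<not> 2 dvd q" "\<not> 3 dvd q"
      using nd by blast+
    ultimately show "p = q" by presburger
  qed
  moreover have "(\<lambda>p. p div 3) ` ?A \<subseteq> {1..k div 3}"
    by (auto simp: div_le_mono Suc_le_eq div_greater_zero_iff)
  ultimately have "card ?A \<le> k div 3"
    using card_inj_on_le[of "\<lambda>p. p div 3" ?A "{1..k div 3}"] by simp
  have "p \<in> ?A \<union> {2, 3}" if "prime p" "p \<le> k" for p
    using that prime_ge_2_nat[of p] by auto
  then have "{p. prime p \<and> p \<le> k} \<subseteq> ?A \<union> {2, 3}" by blast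
  then have "card {p. prime p \<and> p \<le> k} \<le> card (?A \<union> {2, 3})"
    using fin by (intro card_mono) auto
  also have "\<dots> \<le> card ?A + card {2::nat, 3}" by (rule card_Un_le)
  finally show ?thesis using \<open>card ?A \<le> k div 3\<close> by simp
qed

text \<open>A prime above \<open>k\<close> has square exceeding \<open>x\<close>, so its exponent is
  at most 1 and the primorial absorbs it. Each remaining prime costs at most a factor
  \<open>x\<close>.\<close>

lemma prod_prime_powers_le:
  assumes e: "\<And>p. prime p \<Longrightarrow> p \<le> x \<Longrightarrow> p ^ e p \<le> x"
    and k: "x < Suc k ^ 2" and "0 < x"
  shows "(\<Prod>p | prime p \<and> p \<le> x. p ^ e p) \<le> primorial x * x ^ (k div 3 + 2)"
proof -
  let ?S = "{p. prime p \<and> p \<le> x}"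
  let ?f = "\<lambda>p. if p \<le> k then x else 1"
  have "(\<Prod>p\<in>?S. p ^ e p) \<le> (\<Prod>p\<in>?S. p * ?f p)"
  proof (rule prod_mono, safe)
    fix p assume p: "prime p" "p \<le> x"
    show "p ^ e p \<le> p * ?f p"
    proof (cases "p \<le> k")
      case True
      have "p ^ e p \<le> 1 * x" using e[OF p] by simp
      also have "\<dots> \<le> p * x" using p prime_ge_1_nat by (intro mult_le_mono1)
      finally show ?thesis using True by simp
    next
      case False
      have "Suc k ^ 2 \<le> p ^ 2" using False by (intro power_mono) auto
      then have "p ^ e p < p ^ 2" using e[OF p] k by linarith
      then have "e p < 2" using p prime_gt_1_nat power_less_imp_less_exp by blast
      then have "p ^ e p \<le> p ^ 1" using p prime_ge_1_nat by (intro power_increasing) auto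
      with False show ?thesis by simp
    qed
  qed
  also have "\<dots> = primorial x * x ^ card (?S \<inter> {p. p \<le> k})"
    by (simp add: prod.distrib primorial_def prod.If_cases finite_primes_le)
  also have "\<dots> \<le> primorial x * x ^ (k div 3 + 2)"
  proof -
    have "card (?S \<inter> {p. p \<le> k}) \<le> card {p. prime p \<and> p \<le> k}"
      by (intro card_mono finite_primes_le) auto
    then show ?thesis
      using card_primes_le[of k] \<open>0 < x\<close> by (intro mult_left_mono power_increasing) auto
  qed
  finally show ?thesis .
qed

section \<open>Lower bound for the Chebyshev quotient\<close>

lemma fact_add_2: "fact (m + 2) = (m + 2) * (m + 1) * (fact m :: nat)"
  by (simp add: numeral_eq_Suc mult.assoc del: mult_Suc mult_Suc_right)

lemma fact_add_3: "fact (m + 3) = (m + 3) * (m + 2) * (m + 1) * (fact m :: nat)"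
  by (simp add: numeral_eq_Suc mult.assoc del: mult_Suc mult_Suc_right)

lemma fact_add_6:
  "fact (m + 6) = (m + 6) * (m + 5) * (m + 4) * (m + 3) * (m + 2) * (m + 1) * (fact m :: nat)"
  by (simp add: numeral_eq_Suc mult.assoc del: mult_Suc mult_Suc_right)

text \<open>Consecutive quotients have ratio 6(6n+1)(6n+5) / ((n+1)(2n+1)), which tends to 108 from
  below; the factor 4n compensates for the deficit. The maximum with 1 handles n = 0.\<close>

lemma fact_quotient_ge:
  "108 ^ n * (fact (3 * n) * fact (2 * n) ^ 2) \<le> max 1 (4 * n) * (fact (6 * n) * fact n :: nat)"
proof (induction n)
  case 0
  then show ?case by simp
next
  case (Suc n)
  let ?A = "fact (3 * n) * fact (2 * n) ^ 2 :: nat" and ?B = "fact (6 * n) * fact n :: nat"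
  define a b c d g h :: nat
    where "a = n + 1" and "b = 2 * n + 1" and "c = 3 * n + 1" and "d = 3 * n + 2"
      and "g = 6 * n + 5" and "h = 6 * n + 1"
  have lin: "2 * n + 2 = 2 * a" "3 * n + 3 = 3 * a" "6 * n + 2 = 2 * c" "6 * n + 3 = 3 * b"
    "6 * n + 4 = 2 * d" "6 * n + 6 = 6 * a"
    by (simp_all add: a_def b_def c_def d_def)
  \<comment> \<open>\<open>w\<close> is the common factor of the two increments; cancelling it
    leaves \<open>a * b\<close> against \<open>6 * g * h\<close>.\<close>
  define w where "w = 12 * a\<^sup>2 * b * c * d"
  have f3: "fact (3 * n + 3) = 3 * a * d * c * fact (3 * n)"
    unfolding lin[symmetric] c_def d_def by (rule fact_add_3)
  have f2: "fact (2 * n + 2) = 2 * a * b * fact (2 * n)"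
    unfolding lin[symmetric] b_def by (rule fact_add_2)
  have f6: "fact (6 * n + 6) =
      6 * a * g * (2 * d) * (3 * b) * (2 * c) * h * fact (6 * n)"
    unfolding lin[symmetric] g_def h_def by (rule fact_add_6)
  have f1: "fact (Suc n) = a * fact n"
    by (simp add: a_def)
  have Suc_eqs: "3 * Suc n = 3 * n + 3" "2 * Suc n = 2 * n + 2" "6 * Suc n = 6 * n + 6"
    by simp_all
  have A: "fact (3 * Suc n) * fact (2 * Suc n) ^ 2 = w * (a * b) * ?A"
    unfolding Suc_eqs(1,2) f2 f3 w_def by (simp add: power2_eq_square)
  have B: "fact (6 * Suc n) * fact (Suc n) = w * (6 * g * h) * ?B"
    unfolding Suc_eqs(3) f1 f6 w_def by (simp add: power2_eq_square)
  have "108 * max 1 (4 * n) * (a * b) \<le> 4 * Suc n * (6 * g * h)"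
    unfolding a_def b_def g_def h_def by (cases "n = 0") (auto simp: max_def algebra_simps)
  then have "108 * max 1 (4 * n) * (a * b) * (w * ?B)
      \<le> 4 * Suc n * (6 * g * h) * (w * ?B)"
    by (rule mult_le_mono1)
  moreover have "108 * (w * (a * b)) * (108 ^ n * ?A) \<le> 108 * (w * (a * b)) * (max 1 (4 * n) * ?B)"
    by (intro mult_le_mono2 Suc.IH)
  ultimately have "108 * (w * (a * b)) * (108 ^ n * ?A)
      \<le> 4 * Suc n * (6 * g * h) * (w * ?B)"
    by (simp only: mult_ac)
  moreover have "max 1 (4 * Suc n) = 4 * Suc n" by simp
  ultimately show ?case unfolding A B power_Suc by (simp only: mult_ac)
qed

section \<open>Numerical growth estimates\<close>

text \<open>The tangent to \<open>ln\<close> at 52, with ln 52 rounded up to 4. It is sharp enough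
  for arguments near 37, where the growth estimate is tightest.\<close>

lemma ln_le_tangent: "ln t \<le> 3 + t / 52" if "0 < t" for t :: real
proof -
  \<comment> \<open>Expanding at 1/4 and taking the 16th power gives about 52.7; the same polynomial
    at 4 would give only 13.\<close>
  have "1 + 1 / 4 + (1 / 4)\<^sup>2 / 2 \<le> exp (1 / 4 :: real)"
    by (rule exp_lower_Taylor_quadratic) simp
  then have "(1 + 1 / 4 + (1 / 4)\<^sup>2 / 2) ^ 16 \<le> exp (1 / 4 :: real) ^ 16"
    by (intro power_mono) auto
  also have "\<dots> = exp 4" by (simp add: exp_of_nat_mult[symmetric])
  finally have "52 \<le> exp (4 :: real)" by (simp add: power2_eq_square power_divide)
  then have "ln (52 :: real) \<le> ln (exp 4)" by (subst ln_le_cancel_iff) auto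
  then have "ln (52 :: real) \<le> 4" by simp
  moreover have "ln (t / 52) \<le> t / 52 - 1" using that by (intro ln_le_minus_one) simp
  ultimately show ?thesis using that by (simp add: ln_div)
qed

lemma ln_27_16_ge: "0.52 \<le> ln (27 / 16 :: real)"
  using ln_approx_bounds[of "27 / 16" 2] by (simp add: eval_nat_numeral)

text \<open>With s = sqrt(6n), taking logarithms and bounding \<open>ln s\<close> by its tangent
  turns the claim into a quadratic inequality in \<open>s\<close>. It holds from s = 37 on, and 6 *
  230 = 1380 exceeds 37^2. The factor 256 n collects 4n from the quotient bound and 64 from rounding
  \<open>x\<close> to a multiple of 6.\<close>

lemma growth_bound:
  fixes n k :: nat
  assumes "230 \<le> n" "k\<^sup>2 \<le> 6 * n"
  shows "256 * n * 64 ^ n * (6 * n) ^ (k div 3 + 2) < 108 ^ n"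
proof -
  define s where "s = sqrt (6 * real n)"
  have s2: "s\<^sup>2 = 6 * real n" by (simp add: s_def)
  have "37\<^sup>2 \<le> s\<^sup>2" using assms(1) unfolding s2 by simp
  then have s: "37 \<le> s" by (rule power2_le_imp_le) (simp add: s_def)
  have "real (k\<^sup>2) \<le> real (6 * n)"
    using assms(2) by (simp only: of_nat_le_iff)
  then have "real k ^ 2 \<le> s\<^sup>2"
    unfolding s2 by simp
  then have "real k \<le> s" by (rule power2_le_imp_le) (use s in simp)
  moreover have "real (k div 3) \<le> real k / 3"
    using of_nat_div_le_of_nat[of k 3, where 'a = real] by simp
  ultimately have N: "real (k div 3 + 2) \<le> s / 3 + 2" by simp
  have ln_s: "ln s \<le> 3 + s / 52" using s by (intro ln_le_tangent) simp
  have ln6n: "ln (6 * real n) = 2 * ln s"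
    using s unfolding s2[symmetric] by (simp add: ln_realpow)
  have "ln (256 * real n) = ln (128 / 3) + ln (6 * real n)"
    using assms(1) ln_mult_pos[of "128 / 3" "6 * real n"] by simp
  also have "\<dots> \<le> 3 + 128 / 3 / 52 + 2 * ln s"
    unfolding ln6n by (intro add_mono ln_le_tangent) auto
  finally have 1: "ln (256 * real n) \<le> 3 + 128 / 3 / 52 + 2 * ln s" .
  have 2: "real (k div 3 + 2) * ln (6 * real n) \<le> (s / 3 + 2) * (2 * ln s)"
    unfolding ln6n using N s by (intro mult_right_mono) auto
  have "(s / 3 + 3) * (2 * ln s) \<le> (s / 3 + 3) * (2 * (3 + s / 52))"
    using ln_s s by (intro mult_left_mono) auto
  moreover have "3 + 128 / 3 / 52 + (s / 3 + 3) * (2 * (3 + s / 52)) < 0.52 * (s\<^sup>2 / 6)"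
  proof -
    \<comment> \<open>With \<open>s * s\<close> treated as an atom, this makes the quadratic
      inequality linear.\<close>
    have "37 * s \<le> s * s" using s by simp
    moreover have "(s / 3 + 3) * (2 * (3 + s / 52)) = s * s / 78 + 55 / 26 * s + 18"
      by (simp add: field_simps)
    ultimately show ?thesis using s unfolding power2_eq_square by linarith
  qed
  moreover have "(s / 3 + 3) * (2 * ln s) = (s / 3 + 2) * (2 * ln s) + 2 * ln s"
    by (simp add: algebra_simps)
  ultimately have 3: "ln (256 * real n) + real (k div 3 + 2) * ln (6 * real n) < 0.52 * real n"
    using 1 2 s2 by simp
  have ln_powers: "ln (u * v ^ i * w ^ j) = ln u + real i * ln v + real j * ln w"
    if "0 < u" "0 < v" "0 < w" for u v w :: real and i j
    using that by (simp add: ln_mult_pos ln_realpow)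
  have "0.52 * real n \<le> ln (27 / 16) * real n"
    using ln_27_16_ge by (intro mult_right_mono) auto
  also have "ln (27 / 16 :: real) = ln 108 - ln 64"
    using ln_div[of 108 "64 :: real"] by simp
  finally have "ln (256 * real n) + real n * ln 64 + real (k div 3 + 2) * ln (6 * real n)
      < real n * ln 108"
    using 3 by (simp add: algebra_simps)
  then have "ln (256 * real n * 64 ^ n * (6 * real n) ^ (k div 3 + 2)) < ln (108 ^ n)"
    using assms(1) by (subst ln_powers) (simp_all only: ln_realpow)
  then have "256 * real n * 64 ^ n * (6 * real n) ^ (k div 3 + 2) < 108 ^ n"
    using assms(1) by (subst (asm) ln_less_cancel_iff) auto
  then have "real (256 * n * 64 ^ n * (6 * n) ^ (k div 3 + 2)) < real (108 ^ n)"
    by simp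
  then show ?thesis by (simp only: of_nat_less_iff)
qed

section \<open>The range from 1380 on\<close>

lemma primorial_gt_large:
  assumes "1380 \<le> x"
  shows "2 ^ (x + 1) < primorial x"
proof (rule ccontr)
  assume "\<not> 2 ^ (x + 1) < primorial x"
  define n where "n = x div 6"
  have n: "230 \<le> n" using assms by (simp add: n_def)
  have x: "6 * n \<le> x" "x + 1 \<le> 6 * n + 6" by (auto simp: n_def)
  define k where "k = floor_sqrt (6 * n)"
  have k: "k\<^sup>2 \<le> 6 * n" "6 * n < (Suc k)\<^sup>2"
    unfolding k_def using Suc_floor_sqrt_power2_gt by auto
  \<comment> \<open>The exponent \<open>e p\<close> is the integer part of the logarithm of 6n to
    base \<open>p\<close>.\<close>
  have "\<forall>p. \<exists>e. prime p \<and> p \<le> 6 * n \<longrightarrow> p ^ e \<le> 6 * n \<and> 6 * n < p ^ (e + 1)"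
    using ex_power_ivl1[of _ "6 * n"] n prime_ge_2_nat by (metis le_trans one_le_numeral)
  then obtain e where e: "\<And>p. prime p \<Longrightarrow> p \<le> 6 * n \<Longrightarrow> p ^ e p \<le> 6 * n"
    "\<And>p. prime p \<Longrightarrow> p \<le> 6 * n \<Longrightarrow> 6 * n < p ^ Suc (e p)"
    by (metis Suc_eq_plus1)
  let ?A = "fact (3 * n) * fact (2 * n) ^ 2 :: nat" and ?B = "fact (6 * n) * fact n :: nat"
  let ?D = "\<Prod>p | prime p \<and> p \<le> 6 * n. p ^ e p" and ?N = "k div 3 + 2"
  have "?D > 0" by (intro prod_pos) (auto simp: prime_gt_0_nat)
  moreover have "?B dvd ?A * ?D"
    using fact_mult_fact_dvd[OF e(2)] by simp
  ultimately have "?B \<le> ?A * ?D" by (intro dvd_imp_le) auto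
  also have "\<dots> \<le> ?A * (primorial (6 * n) * (6 * n) ^ ?N)"
    using k n e(1) by (intro mult_left_mono prod_prime_powers_le) auto
  finally have B: "?B \<le> ?A * (primorial (6 * n) * (6 * n) ^ ?N)" .
  have "primorial (6 * n) \<le> primorial x" using x by (intro primorial_mono)
  also have "\<dots> \<le> 2 ^ (x + 1)" using \<open>\<not> 2 ^ (x + 1) < primorial x\<close> by simp
  also have "\<dots> \<le> 2 ^ (6 * n + 6)" using x by (intro power_increasing) auto
  also have "\<dots> = 64 * 64 ^ n" by (simp add: power_add power_mult)
  finally have P: "primorial (6 * n) \<le> 64 * 64 ^ n" .
  have "?A * 108 ^ n \<le> 4 * n * ?B" using fact_quotient_ge[of n] n by (simp add: mult.commute)
  also have "\<dots> \<le> 4 * n * (?A * (64 * 64 ^ n * (6 * n) ^ ?N))"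
    using B P by (meson le_trans mult_le_mono order_refl)
  also have "\<dots> = ?A * (256 * n * 64 ^ n * (6 * n) ^ ?N)" by (simp add: mult_ac)
  finally have "108 ^ n \<le> 256 * n * 64 ^ n * (6 * n) ^ ?N" by (subst (asm) mult_le_cancel1) auto
  with growth_bound[OF n k(1)] show False by simp
qed

lemma primorial_gt:
  assumes "31 \<le> x"
  shows "2 ^ (x + 1) < primorial x"
  using assms primorial_gt_small[of x] primorial_gt_large[of x] by linarith

section \<open>From primorials to the enumeration of primes\<close>

lemma nth_prime_1: "nth_prime 1 = 2"
  unfolding nth_prime_def by (auto simp: enumerate_0 prime_ge_2_nat intro!: Least_equality)

text \<open>Computes one prime from its predecessor. The separate index \<open>j\<close> lets both
  positions be given as numerals.\<close>

lemma nth_prime_next: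
  assumes "nth_prime i = p" "0 < i" "j = Suc i" "prime q" "p < q" "\<forall>m\<in>{p<..<q}. \<not> prime m"
  shows "nth_prime j = q"
proof -
  obtain l where "i = Suc l" using assms(2) gr0_implies_Suc by blast
  then show ?thesis
    using assms unfolding nth_prime_def
    by (auto simp: enumerate_Suc''[OF primes_infinite] intro!: Least_equality)
qed

lemma strict_mono_nth_prime: "nth_prime (Suc i) < nth_prime (Suc j) \<longleftrightarrow> i < j"
  unfolding nth_prime_def using primes_infinite by simp

lemma prod_nth_prime: "(\<Prod>i=1..r. nth_prime i) = primorial (nth_prime (r + 1) - 1)"
proof -
  have pos: "prime (nth_prime i)" for i
    unfolding nth_prime_def using enumerate_in_set[OF primes_infinite] by simp
  have inj: "inj_on nth_prime {1..r}"
  proof (rule inj_onI)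
    fix i j assume "i \<in> {1..r}" "j \<in> {1..r}" "nth_prime i = nth_prime j"
    then show "i = j"
      using injD[OF inj_enumerate[OF primes_infinite], of "i - 1" "j - 1"]
      unfolding nth_prime_def by auto
  qed
  have "nth_prime ` {1..r} = {p. prime p \<and> p \<le> nth_prime (r + 1) - 1}"
  proof (intro equalityI subsetI)
    fix p assume "p \<in> nth_prime ` {1..r}"
    then obtain i where "p = nth_prime (Suc i)" "i < r"
      unfolding image_Suc_lessThan[symmetric] by blast
    then show "p \<in> {p. prime p \<and> p \<le> nth_prime (r + 1) - 1}"
      using pos strict_mono_nth_prime[of i r] by simp
  next
    fix p assume "p \<in> {p. prime p \<and> p \<le> nth_prime (r + 1) - 1}"
    then have p: "prime p" "p < nth_prime (Suc r)" using prime_gt_0_nat[OF pos[of "r + 1"]] by auto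
    obtain i where i: "p = nth_prime (Suc i)"
      using enumerate_Ex[OF primes_infinite, of p] p(1) unfolding nth_prime_def by auto
    then have "i < r" using p(2) strict_mono_nth_prime by simp
    then show "p \<in> nth_prime ` {1..r}" unfolding i by auto
  qed
  then show ?thesis
    unfolding primorial_def using prod.reindex[OF inj, of "\<lambda>p. p"] by simp
qed

theorem corollary1:
  shows "(\<forall>r::nat. r \<ge> 10 \<longrightarrow> (\<Prod>i=1..r. nth_prime i) > 2 ^ nth_prime (r + 1)) \<and>
         (\<forall>r::nat. 0 < r \<and> r < 10 \<and> r \<noteq> 8 \<longrightarrow> (\<Prod>i=1..r. nth_prime i) < 2 ^ nth_prime (r + 1))"
proof -
  have p1: "nth_prime 1 = 2" by (rule nth_prime_1)
  have range: "{a<..<b} = set [a + 1..<b]" for a b :: nat by auto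
  note next_prime = nth_prime_next[unfolded range]
  have p2: "nth_prime 2 = 3" using next_prime[OF p1, of 2 3] by simp
  have p3: "nth_prime 3 = 5" using next_prime[OF p2, of 3 5] by simp
  have p4: "nth_prime 4 = 7" using next_prime[OF p3, of 4 7] by simp
  have p5: "nth_prime 5 = 11" using next_prime[OF p4, of 5 11] by simp
  have p6: "nth_prime 6 = 13" using next_prime[OF p5, of 6 13] by simp
  have p7: "nth_prime 7 = 17" using next_prime[OF p6, of 7 17] by simp
  have p8: "nth_prime 8 = 19" using next_prime[OF p7, of 8 19] by simp
  have p9: "nth_prime 9 = 23" using next_prime[OF p8, of 9 23] by simp
  have p10: "nth_prime 10 = 29" using next_prime[OF p9, of 10 29] by simp
  have p11: "nth_prime 11 = 31" using next_prime[OF p10, of 11 31] by simp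
  have prod_numeral: "(\<Prod>i=1..numeral k. nth_prime i) =
      (\<Prod>i=1..pred_numeral k. nth_prime i) * nth_prime (numeral k)" for k
    by (simp add: numeral_eq_Suc)
  note products = prod_numeral[simplified] p1[simplified] p2 p3 p4 p5 p6 p7 p8 p9 p10 p11
  \<comment> \<open>The case r = 10 is computed, because there x = 30 lies just below the range of
    \<open>primorial_gt\<close>.\<close>
  have "2 ^ nth_prime (r + 1) < (\<Prod>i=1..r. nth_prime i)" if "10 \<le> r" for r
  proof (cases "r = 10")
    case True
    then show ?thesis by (simp add: products)
  next
    case False
    then have "nth_prime 11 < nth_prime (r + 1)"
      using that strict_mono_nth_prime[of 10 r] by simp
    then show ?thesis
      using primorial_gt[of "nth_prime (r + 1) - 1"] unfolding prod_nth_prime p11 by simp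
  qed
  moreover have "(\<Prod>i=1..r. nth_prime i) < 2 ^ nth_prime (r + 1)" if "0 < r" "r < 10" "r \<noteq> 8" for r
  proof -
    \<comment> \<open>The value 8 is a true exception: the product is 9699690, whereas 2^23 =
      8388608.\<close>
    have "r \<in> {1, 2, 3, 4, 5, 6, 7, 9}" using that by auto
    then show ?thesis by (auto simp: products p2[unfolded numeral_2_eq_2])
  qed
  ultimately show ?thesis by blast
qed

end
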